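(* Let $a,b$ be real numbers with $0\le a<b$, let $\alpha>0$ and $\rho>0$ be real numbers, and let $x:[a,b]\to\mathbb{R}$ be a function of class $C^1$. For $N\in\mathbb{N}$ (with $N\geq 1$) and $k\in\{1,\ldots,N\}$ define $$A=A_N=\frac{\rho^{-\alpha}}{\Gamma(\alpha+1)}\left[1+\sum_{k=1}^N\frac{\Gamma(k-\alpha)}{\Gamma(-\alpha)\,k!}\right],\qquad B_k=\frac{\rho^{1-\alpha}\,\Gamma(k-\alpha)}{\Gamma(\alpha+1)\,\Gamma(-\alpha)\,(k-1)!},$$ and define $V_k:[a,b]\to\mathbb{R}$ by $$V_k(t)=\int_a^t \tau^{\rho-1}(\tau^\rho-a^\rho)^{k-1}x(\tau)\,d\tau.$$ For $t\in(a,b]$ define $E_N(t)$ by the identity $$I_{a+}^{\alpha,\rho}x(t)=A\,(t^\rho-a^\rho)^\alpha x(t)-\sum_{k=1}^N B_k\,(t^\rho-a^\rho)^{\alpha-k}V_k(t)+E_N(t).$$ Then for every $t\in(a,b]$, $$\lim_{N\to\infty}E_N(t)=0.$$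
   Context: The left Katugampola fractional integral of order $\alpha>0$ with parameter $\rho>0$ of an integrable function $x:[a,b]\to\mathbb{R}$, where $0\le a<b$, is $$I_{a+}^{\alpha,\rho}x(t)=\frac{\rho^{1-\alpha}}{\Gamma(\alpha)}\int_a^t \tau^{\rho-1}(t^\rho-\tau^\rho)^{\alpha-1}x(\tau)\,d\tau.$$ Here $\Gamma$ is Euler's Gamma function. Convention: for a positive integer $k$, the quotient $\Gamma(k-\alpha)/\Gamma(-\alpha)$ denotes the product $\prod_{j=0}^{k-1}(j-\alpha)$; for non-integer $\alpha$ this equals the literal quotient of Gamma values, and for integer $\alpha$ it is the limiting value of the quotient. *)

theory Defs
  imports "HOL-Analysis.Analysis"
begin

text \<open>Class \<open>C\<^sup>1\<close> on the closed interval \<open>[a,b]\<close>, with one-sided derivatives at the endpoints.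
  (The library's \<open>C1_differentiable_on\<close> asks for two-sided derivatives and would therefore
  constrain the values outside the interval.)\<close>

definition C1_on_interval :: "real \<Rightarrow> real \<Rightarrow> (real \<Rightarrow> real) \<Rightarrow> bool" where
  "C1_on_interval a b x \<longleftrightarrow>
     (\<exists>x'. (\<forall>t\<in>{a..b}. (x has_real_derivative x' t) (at t within {a..b})) \<and>
           continuous_on {a..b} x')"

text \<open>In the integrals below, \<open>0 powr r = 0\<close> replaces the undefined (or unit) values of the
  powers at the endpoints of the interval of integration; this only concerns a null set.\<close>

definition katugampola_integral ::
  "real \<Rightarrow> real \<Rightarrow> real \<Rightarrow> (real \<Rightarrow> real) \<Rightarrow> real \<Rightarrow> real" where
  "katugampola_integral a \<alpha> \<rho> x t =
     \<rho> powr (1 - \<alpha>) / Gamma \<alpha> *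
     (LINT \<tau>:{a..t}|lborel. \<tau> powr (\<rho> - 1) * (t powr \<rho> - \<tau> powr \<rho>) powr (\<alpha> - 1) * x \<tau>)"

text \<open>The quotient \<open>\<Gamma>(k - \<alpha>) / \<Gamma>(-\<alpha>)\<close>, read as a product so that integer \<open>\<alpha>\<close> is covered: there
  \<open>Gamma (- \<alpha>) = 0\<close> in HOL, and the literal quotient would be \<open>0\<close> by division by zero.\<close>

definition Gamma_quot :: "real \<Rightarrow> nat \<Rightarrow> real" where
  "Gamma_quot \<alpha> k = (\<Prod>j<k. real j - \<alpha>)"

lemma Gamma_quot_eq:
  assumes "\<alpha> \<notin> \<int>"
  shows "Gamma_quot \<alpha> k = Gamma (real k - \<alpha>) / Gamma (- \<alpha>)"
proof -
  have "- \<alpha> \<notin> \<int>\<^sub>\<le>\<^sub>0"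
    using assms nonpos_Ints_Int by fastforce
  then have "Gamma (- \<alpha> + real k) / Gamma (- \<alpha>) = pochhammer (- \<alpha>) k"
    by (simp add: pochhammer_Gamma)
  moreover have "Gamma_quot \<alpha> k = pochhammer (- \<alpha>) k"
    by (simp add: Gamma_quot_def pochhammer_prod atLeast0LessThan)
  ultimately show ?thesis
    by simp
qed

definition A_coeff :: "real \<Rightarrow> real \<Rightarrow> nat \<Rightarrow> real" where
  "A_coeff \<alpha> \<rho> N =
     \<rho> powr (- \<alpha>) / Gamma (\<alpha> + 1) * (1 + (\<Sum>k=1..N. Gamma_quot \<alpha> k / fact k))"

definition B_coeff :: "real \<Rightarrow> real \<Rightarrow> nat \<Rightarrow> real" where
  "B_coeff \<alpha> \<rho> k =
     \<rho> powr (1 - \<alpha>) * Gamma_quot \<alpha> k / (Gamma (\<alpha> + 1) * fact (k - 1))"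

definition V_fun :: "real \<Rightarrow> real \<Rightarrow> (real \<Rightarrow> real) \<Rightarrow> nat \<Rightarrow> real \<Rightarrow> real" where
  "V_fun a \<rho> x k t =
     (LINT \<tau>:{a..t}|lborel. \<tau> powr (\<rho> - 1) * (\<tau> powr \<rho> - a powr \<rho>) ^ (k - 1) * x \<tau>)"

end

theory Submission
  imports Defs
begin

text \<open>Put \<open>s(\<tau>) = (\<tau>\<^sup>\<rho> - a\<^sup>\<rho>) / (t\<^sup>\<rho> - a\<^sup>\<rho>)\<close>, let \<open>c\<^sub>k = \<Gamma>(k - \<alpha>) / (\<Gamma>(-\<alpha>) k!)\<close> be the Taylor
  coefficients of \<open>(1 - s)\<^sup>\<alpha>\<close>, and let \<open>G\<^sub>N(\<tau>) = (1 - s)\<^sup>\<alpha> - (\<Sum>k\<le>N. c\<^sub>k s\<^sup>k)\<close>. The derivative of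
  \<open>G\<^sub>N\<close> is a combination of the kernel of the fractional integral and of the kernels of the \<open>V\<^sub>k\<close>.
  One integration by parts of \<open>G\<^sub>N x'\<close> therefore shows that \<open>E\<^sub>N(t)\<close> is a constant times
  \<open>\<integral> G\<^sub>N x'\<close>. As \<open>\<alpha> > 0\<close>, the binomial series converges absolutely even at \<open>s = 1\<close>,
  so \<open>G\<^sub>N\<close> tends to zero uniformly.\<close>

section \<open>The binomial series of \<open>(1 - s) powr \<alpha>\<close> on the closed unit
  interval\<close>

lemma Gamma_quot_Suc_over_fact:
  "(real k + 1) * (Gamma_quot \<alpha> (Suc k) / fact (Suc k)) = (real k - \<alpha>) * (Gamma_quot \<alpha> k / fact k)"
  by (simp add: Gamma_quot_def divide_simps del: of_nat_Suc)

lemma Gamma_quot_over_fact_eq_gbinomial: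
  "Gamma_quot \<alpha> k / fact k = (-1) ^ k * (\<alpha> gchoose k)"
  by (simp add: gbinomial_pochhammer Gamma_quot_def pochhammer_prod atLeast0LessThan
      flip: power_add mult_2)

text \<open>For non-integer \<alpha> the ratio of consecutive terms tends to 1, so the ratio test
  gives nothing. The recurrence instead bounds the partial sums from index \<open>m\<close> on by
  \<open>m * c m / \<alpha>\<close>, since the subtracted end term of the telescoping sum is
  nonnegative.\<close>

lemma summable_abs_binomial_coefficients:
  assumes "\<alpha> > 0"
  shows "summable (\<lambda>k. \<bar>Gamma_quot \<alpha> k / fact k\<bar>)"
proof -
  define c where "c k = \<bar>Gamma_quot \<alpha> k / fact k\<bar>" for k
  define m where "m = nat \<lceil>\<alpha>\<rceil>"
  \<comment> \<open>for \<open>k \<ge> \<alpha>\<close> the term \<open>\<alpha> * c k\<close> telescopes\<close>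
  have step: "\<alpha> * c k = real k * c k - real (Suc k) * c (Suc k)" if "k \<ge> m" for k
  proof -
    have "real k - \<alpha> \<ge> 0"
      using that unfolding m_def by linarith
    then have "(real k + 1) * c (Suc k) = (real k - \<alpha>) * c k"
      using arg_cong[OF Gamma_quot_Suc_over_fact[of k \<alpha>], of abs]
      unfolding abs_mult c_def by simp
    then show ?thesis
      by (simp add: algebra_simps)
  qed
  have "\<alpha> * (\<Sum>i<n. c (i + m)) = real m * c m - real (n + m) * c (n + m)" for n
    by (induction n) (auto simp: distrib_left step)
  then have "\<alpha> * (\<Sum>i<n. c (i + m)) \<le> real m * c m" for n
    by (simp add: c_def)
  then have "(\<Sum>i<n. c (i + m)) \<le> real m * c m / \<alpha>" for n
    using assms by (simp add: field_simps)
  then have "summable (\<lambda>i. c (i + m))"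
    by (intro summableI_nonneg_bounded) (auto simp: c_def)
  then have "summable c"
    using summable_iff_shift by blast
  then show ?thesis
    by (simp add: c_def[abs_def])
qed

text \<open>Inside the unit interval the remainder is the tail of the series, and
  \<open>s ^ k \<le> 1\<close> removes s from the termwise bound. The bound is thus uniform in s and
  is itself the tail of a convergent series.\<close>

lemma binomial_series_remainder_bound:
  assumes "\<alpha> > 0" and s: "s \<in> {0..1}"
  shows "\<bar>(1 - s) powr \<alpha> - (\<Sum>k\<le>N. Gamma_quot \<alpha> k / fact k * s ^ k)\<bar>
           \<le> (\<Sum>k. \<bar>Gamma_quot \<alpha> (k + Suc N) / fact (k + Suc N)\<bar>)"
proof -
  define c where "c k = Gamma_quot \<alpha> k / fact k" for k
  define r where "r = (\<Sum>k. \<bar>c (k + Suc N)\<bar>)"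
  define f where "f s = \<bar>(1 - s) powr \<alpha> - (\<Sum>k\<le>N. c k * s ^ k)\<bar>" for s
  have sm: "summable (\<lambda>k. \<bar>c k\<bar>)"
    using summable_abs_binomial_coefficients[OF assms(1)] by (simp add: c_def)
  then have sm': "summable (\<lambda>k. \<bar>c (k + Suc N)\<bar>)"
    using summable_iff_shift[of "\<lambda>k. \<bar>c k\<bar>" "Suc N"] by simp
  have less: "f u \<le> r" if "u \<in> {0<..<1}" for u
  proof -
    have "(\<lambda>k. (\<alpha> gchoose k) * (-u) ^ k) sums (1 - u) powr \<alpha>"
      using gen_binomial_real[of "-u" \<alpha>] that by simp
    moreover have "(\<alpha> gchoose k) * (-u) ^ k = c k * u ^ k" for k
      unfolding c_def Gamma_quot_over_fact_eq_gbinomial by (simp add: power_minus[of u] mult_ac)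
    ultimately have S: "(\<lambda>k. c k * u ^ k) sums (1 - u) powr \<alpha>"
      by simp
    have le: "norm (c (k + Suc N) * u ^ (k + Suc N)) \<le> \<bar>c (k + Suc N)\<bar>" for k
      using mult_left_mono[OF power_le_one[of u "k + Suc N"], of "\<bar>c (k + Suc N)\<bar>"] that
      by (simp add: abs_mult del: power_Suc add_Suc_right)
    have "(\<lambda>k. c (k + Suc N) * u ^ (k + Suc N)) sums ((1 - u) powr \<alpha> - (\<Sum>k<Suc N. c k * u ^ k))"
      by (rule iffD2[OF sums_iff_shift' S])
    then have "f u = norm (\<Sum>k. c (k + Suc N) * u ^ (k + Suc N))"
      unfolding f_def by (simp add: sums_iff lessThan_Suc_atMost)
    also have "\<dots> \<le> r"
      unfolding r_def by (rule norm_suminf_le[OF le sm'])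
    finally show ?thesis .
  qed
  \<comment> \<open>The series expansion was used only for \<open>0 < u < 1\<close>; the endpoints
    follow by closure. At \<open>s = 1\<close> the base of the power vanishes, and continuity there
    rests on \<open>\<alpha> > 0\<close>.\<close>
  have "continuous_on {0..1} f"
    unfolding f_def using assms(1) by (intro continuous_intros continuous_on_powr') auto
  then have "f s \<le> r"
    using continuous_le_on_closure[of "{0<..<1}" f s r] less s by simp
  then show ?thesis
    by (simp add: f_def r_def c_def)
qed

section \<open>Integrals with possibly singular weights\<close>

text \<open>Links the Lebesgue integrals of the definitions to the gauge integral of the fundamental
  theorem. The kernels may be unbounded at t (if \<open>\<alpha> < 1\<close>) or at 0 (if
  \<open>a = 0\<close> and \<open>\<rho> < 1\<close>), but they have primitives continuous up to the
  endpoints. This makes K integrable, nonnegativity makes it absolutely integrable, and the bounded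
  factor x preserves that.\<close>

lemma has_integral_weight_mult_continuous:
  fixes K P x :: "real \<Rightarrow> real"
  assumes "a \<le> t"
    and [measurable]: "K \<in> borel_measurable borel"
    and nonneg: "\<And>\<tau>. \<tau> \<in> {a..t} \<Longrightarrow> K \<tau> \<ge> 0"
    and "continuous_on {a..t} P"
    and "\<And>\<tau>. \<tau> \<in> {a<..<t} \<Longrightarrow> (P has_real_derivative K \<tau>) (at \<tau>)"
    and x: "continuous_on {a..t} x"
  shows "((\<lambda>\<tau>. K \<tau> * x \<tau>) has_integral (LINT \<tau>:{a..t}|lborel. K \<tau> * x \<tau>)) {a..t}"
proof -
  have "(K has_integral (P t - P a)) {a..t}"
    using assms by (intro fundamental_theorem_of_calculus_interior)
      (auto simp: has_real_derivative_iff_has_vector_derivative)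
  then have "K absolutely_integrable_on {a..t}"
    using nonneg by (intro nonnegative_absolutely_integrable_1) (auto simp: has_integral_integrable)
  moreover have "x \<in> borel_measurable (lebesgue_on {a..t})"
    using x by (rule continuous_imp_measurable_on_sets_lebesgue) auto
  moreover have "bounded (x ` {a..t})"
    using compact_continuous_image[OF x] by (simp add: compact_imp_bounded)
  ultimately have "(\<lambda>\<tau>. x \<tau> * K \<tau>) absolutely_integrable_on {a..t}"
    by (intro absolutely_integrable_bounded_measurable_product_real) auto
  then have "integrable lebesgue (\<lambda>\<tau>. indicator {a..t} \<tau> *\<^sub>R (K \<tau> * x \<tau>))"
    by (simp add: set_integrable_def mult.commute)
  \<comment> \<open>Passing from the completion \<open>lebesgue\<close> to \<open>lborel\<close>
    takes Borel measurability. Nothing is known about x outside the interval, so the indicator is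
    attached to x.\<close>
  moreover have "(\<lambda>\<tau>. indicator {a..t} \<tau> *\<^sub>R x \<tau>) \<in> borel_measurable borel"
    using x by (intro borel_measurable_continuous_on_indicator) auto
  then have "(\<lambda>\<tau>. K \<tau> * (indicator {a..t} \<tau> *\<^sub>R x \<tau>)) \<in> borel_measurable lborel"
    by measurable
  then have "(\<lambda>\<tau>. indicator {a..t} \<tau> *\<^sub>R (K \<tau> * x \<tau>)) \<in> borel_measurable lborel"
    by (simp add: mult_ac)
  ultimately have "set_integrable lborel {a..t} (\<lambda>\<tau>. K \<tau> * x \<tau>)"
    by (simp add: integrable_completion set_integrable_def)
  from set_borel_integral_eq_integral[OF this] show ?thesis
    by (simp add: has_integral_integral)
qed

lemma has_integral_mult_abs_bound:
  fixes G D :: "real \<Rightarrow> real"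
  assumes "((\<lambda>\<tau>. G \<tau> * D \<tau>) has_integral I) {a..t}" and "a \<le> t"
    and "\<And>\<tau>. \<tau> \<in> {a..t} \<Longrightarrow> \<bar>G \<tau>\<bar> \<le> r" and "\<And>\<tau>. \<tau> \<in> {a..t} \<Longrightarrow> \<bar>D \<tau>\<bar> \<le> M"
  shows "\<bar>I\<bar> \<le> r * M * (t - a)"
proof -
  have "M \<ge> 0" "r \<ge> 0"
    using assms(2) assms(3,4)[of a] by simp_all
  then have "norm I \<le> r * M * measure lborel (cbox a t)"
    using assms by (intro has_integral_bound[of _ "\<lambda>\<tau>. G \<tau> * D \<tau>"]) (auto simp: abs_mult intro!: mult_mono)
  then show ?thesis
    using assms(2) by simp
qed

section \<open>The remainder as an integral against the derivative of x\<close>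

text \<open>The value of the integral is \<open>E N t\<close> solved from its defining identity. In
  the integration by parts the boundary term at t yields \<open>A_coeff\<close>, the derivative of
  the power yields the fractional integral, and the derivative of the Taylor polynomial yields the
  terms with \<open>V_fun\<close>.\<close>

lemma remainder_integral:
  fixes a t \<alpha> \<rho> :: real and x D :: "real \<Rightarrow> real"
  defines "T \<equiv> t powr \<rho> - a powr \<rho>"
  defines "G \<equiv> \<lambda>N \<tau>. (1 - (\<tau> powr \<rho> - a powr \<rho>) / T) powr \<alpha>
                 - (\<Sum>k\<le>N. Gamma_quot \<alpha> k / fact k * ((\<tau> powr \<rho> - a powr \<rho>) / T) ^ k)"
  assumes a: "0 \<le> a" and at: "a < t" and \<alpha>: "\<alpha> > 0" and \<rho>: "\<rho> > 0"
    and x: "continuous_on {a..t} x"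
    and D: "\<And>\<tau>. \<tau> \<in> {a<..<t} \<Longrightarrow> (x has_real_derivative D \<tau>) (at \<tau>)"
  shows "((\<lambda>\<tau>. \<rho> powr (- \<alpha>) / Gamma (\<alpha> + 1) * T powr \<alpha> * (G N \<tau> * D \<tau>)) has_integral
            (katugampola_integral a \<alpha> \<rho> x t - A_coeff \<alpha> \<rho> N * T powr \<alpha> * x t
             + (\<Sum>k=1..N. B_coeff \<alpha> \<rho> k * T powr (\<alpha> - real k) * V_fun a \<rho> x k t))) {a..t}"
proof -
  define c where "c k = Gamma_quot \<alpha> k / fact k" for k
  define u where "u \<tau> = \<tau> powr \<rho> - a powr \<rho>" for \<tau>
  define K where "K \<tau> = \<tau> powr (\<rho> - 1) * (t powr \<rho> - \<tau> powr \<rho>) powr (\<alpha> - 1)" for \<tau>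
  define v where "v k \<tau> = \<tau> powr (\<rho> - 1) * u \<tau> ^ (k - 1)" for k :: nat and \<tau>
  define J where "J = (LINT \<tau>:{a..t}|lborel. K \<tau> * x \<tau>)"
  have G_eq: "G N \<tau> = (1 - u \<tau> / T) powr \<alpha> - (\<Sum>k\<le>N. c k * (u \<tau> / T) ^ k)" for \<tau>
    by (simp add: G_def c_def u_def)
  have T: "T > 0"
    using a at \<rho> by (simp add: T_def powr_less_mono2)
  have c0: "c 0 = 1"
    by (simp add: c_def Gamma_quot_def)
  have ut: "u t = T" and ua: "u a = 0"
    by (simp_all add: u_def T_def)
  have u_nonneg: "u \<tau> \<ge> 0" if "\<tau> \<in> {a..t}" for \<tau>
    using that a \<rho> by (simp add: u_def powr_mono2)
  have u_less: "u \<tau> < T" if "\<tau> \<in> {a<..<t}" for \<tau>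
    using that a \<rho> by (simp add: u_def T_def powr_less_mono2)
  have cont_pow: "continuous_on {a..t} (\<lambda>\<tau>. \<tau> powr \<rho>)"
    using a \<rho> by (intro continuous_on_powr' continuous_intros) auto
  then have cont_u: "continuous_on {a..t} u"
    unfolding u_def by (rule continuous_on_diff[OF _ continuous_on_const])
  have deriv_u: "(u has_real_derivative \<rho> * \<tau> powr (\<rho> - 1)) (at \<tau>)" if "\<tau> \<in> {a<..<t}" for \<tau>
    unfolding u_def using that a by (auto intro!: derivative_eq_intros)
  have deriv_powr: "((\<lambda>\<tau>. (T - u \<tau>) powr \<alpha>) has_real_derivative - (\<alpha> * \<rho> * K \<tau>)) (at \<tau>)"
    if "\<tau> \<in> {a<..<t}" for \<tau>
    using u_less[OF that] that a
    by (auto intro!: derivative_eq_intros DERIV_powr deriv_u[OF that] simp: K_def u_def T_def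
        powr_diff field_simps)
  have K_int: "((\<lambda>\<tau>. K \<tau> * x \<tau>) has_integral J) {a..t}"
    unfolding J_def
  proof (rule has_integral_weight_mult_continuous[where P = "\<lambda>\<tau>. - ((T - u \<tau>) powr \<alpha>) / (\<alpha> * \<rho>)"])
    show "continuous_on {a..t} (\<lambda>\<tau>. - ((T - u \<tau>) powr \<alpha>) / (\<alpha> * \<rho>))"
      using \<alpha> \<rho> cont_u a by (intro continuous_intros continuous_on_powr')
        (auto simp: u_def T_def powr_mono2)
    show "((\<lambda>\<tau>. - ((T - u \<tau>) powr \<alpha>) / (\<alpha> * \<rho>)) has_real_derivative K \<tau>) (at \<tau>)"
      if "\<tau> \<in> {a<..<t}" for \<tau>
      using \<alpha> \<rho> DERIV_cdivide[OF DERIV_minus[OF deriv_powr[OF that]], of "\<alpha> * \<rho>"] by simp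
    show "K \<in> borel_measurable borel"
      unfolding K_def by measurable
  qed (use at x in \<open>auto simp: K_def\<close>)
  have v_int: "((\<lambda>\<tau>. v k \<tau> * x \<tau>) has_integral V_fun a \<rho> x k t) {a..t}" if "k \<ge> 1" for k
  proof -
    have "((\<lambda>\<tau>. v k \<tau> * x \<tau>) has_integral (LINT \<tau>:{a..t}|lborel. v k \<tau> * x \<tau>)) {a..t}"
    proof (rule has_integral_weight_mult_continuous[where P = "\<lambda>\<tau>. u \<tau> ^ k / (k * \<rho>)"])
      show "continuous_on {a..t} (\<lambda>\<tau>. u \<tau> ^ k / (k * \<rho>))"
        using \<rho> that cont_u by (intro continuous_intros) auto
      show "((\<lambda>\<tau>. u \<tau> ^ k / (k * \<rho>)) has_real_derivative v k \<tau>) (at \<tau>)"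
        if "\<tau> \<in> {a<..<t}" for \<tau>
        using \<rho> \<open>k \<ge> 1\<close> by (auto intro!: derivative_eq_intros deriv_u[OF that] simp: v_def)
      show "v k \<in> borel_measurable borel"
        unfolding v_def u_def by measurable
    qed (use at x u_nonneg in \<open>auto simp: v_def\<close>)
    then show ?thesis
      by (simp add: V_fun_def v_def u_def)
  qed
  have cont_G: "continuous_on {a..t} (G N)"
    unfolding G_eq using \<alpha> \<rho> T cont_u a
    by (intro continuous_intros continuous_on_powr') (auto simp: u_def T_def powr_mono2)
  define G' where "G' \<tau> = - (\<alpha> * \<rho> / T powr \<alpha> * K \<tau>) - (\<Sum>k=1..N. c k * k * \<rho> / T ^ k * v k \<tau>)" for \<tau>
  have deriv_G: "(G N has_real_derivative G' \<tau>) (at \<tau>)" if "\<tau> \<in> {a<..<t}" for \<tau>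
  proof -
    have "1 - u y / T = (T - u y) / T" for y
      using T by (simp add: field_simps)
    then have "(1 - u y / T) powr \<alpha> = (T - u y) powr \<alpha> / T powr \<alpha>" if "y \<in> {a<..<t}" for y
      using T u_less[OF that] by (simp add: powr_divide)
    then have eq: "(T - u y) powr \<alpha> / T powr \<alpha> - (\<Sum>k\<le>N. c k * (u y / T) ^ k) = G N y"
      if "y \<in> {a<..<t}" for y
      using that by (simp add: G_eq)
    have 1: "((\<lambda>y. (T - u y) powr \<alpha> / T powr \<alpha>) has_real_derivative - (\<alpha> * \<rho> / T powr \<alpha> * K \<tau>)) (at \<tau>)"
      using DERIV_cdivide[OF deriv_powr[OF that], of "T powr \<alpha>"] by simp
    have 2: "((\<lambda>y. c k * (u y / T) ^ k) has_real_derivative c k * k * \<rho> / T ^ k * v k \<tau>) (at \<tau>)" for k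
    proof -
      \<comment> \<open>For \<open>k = 0\<close> the truncated exponent \<open>k - 1\<close> is
        harmless: the factor k annihilates both sides. The same factor later lets the sum start at
        1.\<close>
      have "c k * (k * (\<rho> * \<tau> powr (\<rho> - 1) / T * (u \<tau> / T) ^ (k - Suc 0))) = c k * k * \<rho> / T ^ k * v k \<tau>"
        by (cases k) (simp_all add: v_def power_divide)
      then show ?thesis
        using DERIV_cmult[OF DERIV_power[OF DERIV_cdivide[OF deriv_u[OF that]], of T k], of "c k"]
        by simp
    qed
    have "((\<lambda>y. (T - u y) powr \<alpha> / T powr \<alpha> - (\<Sum>k\<le>N. c k * (u y / T) ^ k)) has_real_derivative
        - (\<alpha> * \<rho> / T powr \<alpha> * K \<tau>) - (\<Sum>k\<le>N. c k * k * \<rho> / T ^ k * v k \<tau>)) (at \<tau>)"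
      by (intro DERIV_diff 1 DERIV_sum 2)
    also have "(\<Sum>k\<le>N. c k * k * \<rho> / T ^ k * v k \<tau>) = (\<Sum>k=1..N. c k * k * \<rho> / T ^ k * v k \<tau>)"
      by (rule sum.mono_neutral_right) (auto simp: not_less_eq_eq)
    finally show ?thesis
      unfolding G'_def by (rule has_field_derivative_transform_within_open[OF _ open_greaterThanLessThan that eq])
  qed
  \<comment> \<open>The product rule is needed only in the open interval, so endpoint singularities
    of \<open>G'\<close> do no harm. Subtracting the known integral of \<open>G' * x\<close> gives
    both the integrability and the integral of \<open>G N * D\<close>.\<close>
  have "((\<lambda>\<tau>. G' \<tau> * x \<tau> + D \<tau> * G N \<tau>) has_integral (G N t * x t - G N a * x a)) {a..t}"
    using at x cont_G
    by (intro fundamental_theorem_of_calculus_interior continuous_intros)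
      (auto simp flip: has_real_derivative_iff_has_vector_derivative intro!: DERIV_mult deriv_G D)
  moreover have "((\<lambda>\<tau>. - (\<alpha> * \<rho> / T powr \<alpha> * (K \<tau> * x \<tau>))
      - (\<Sum>k=1..N. c k * k * \<rho> / T ^ k * (v k \<tau> * x \<tau>))) has_integral
      (- (\<alpha> * \<rho> / T powr \<alpha> * J) - (\<Sum>k=1..N. c k * k * \<rho> / T ^ k * V_fun a \<rho> x k t))) {a..t}"
    by (intro has_integral_diff has_integral_neg has_integral_sum has_integral_mult_right K_int v_int) auto
  then have "((\<lambda>\<tau>. G' \<tau> * x \<tau>) has_integral
      (- (\<alpha> * \<rho> / T powr \<alpha> * J) - (\<Sum>k=1..N. c k * k * \<rho> / T ^ k * V_fun a \<rho> x k t))) {a..t}"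
    by (simp add: G'_def left_diff_distrib sum_distrib_right mult.assoc)
  ultimately have "((\<lambda>\<tau>. (G' \<tau> * x \<tau> + D \<tau> * G N \<tau>) - G' \<tau> * x \<tau>) has_integral
      ((G N t * x t - G N a * x a)
       - (- (\<alpha> * \<rho> / T powr \<alpha> * J) - (\<Sum>k=1..N. c k * k * \<rho> / T ^ k * V_fun a \<rho> x k t)))) {a..t}"
    by (rule has_integral_diff)
  moreover have "G N a = 0"
    using c0 by (simp add: G_eq ua power_0_left if_distrib sum.delta cong: if_cong)
  \<comment> \<open>At \<open>\<tau> = t\<close> the power is \<open>0 powr \<alpha> = 0\<close>, so
    only the Taylor polynomial at \<open>s = 1\<close> remains; it is the bracket in
    \<open>A_coeff\<close>.\<close>
  moreover have "G N t = - (1 + (\<Sum>k=1..N. c k))"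
  proof -
    have "(\<Sum>k\<le>N. c k) = c 0 + (\<Sum>k=1..N. c k)"
      by (simp add: sum.atLeast_Suc_atMost flip: atLeast0AtMost)
    then show ?thesis
      using T c0 by (simp add: G_eq ut)
  qed
  ultimately have main: "((\<lambda>\<tau>. G N \<tau> * D \<tau>) has_integral
      (- (1 + (\<Sum>k=1..N. c k)) * x t + \<alpha> * \<rho> / T powr \<alpha> * J
       + (\<Sum>k=1..N. c k * k * \<rho> / T ^ k * V_fun a \<rho> x k t))) {a..t}"
    by (simp add: algebra_simps)
  \<comment> \<open>The factor that turns \<open>\<alpha> * \<rho> / T powr \<alpha>\<close> into
    the normalisation \<open>\<rho> powr (1 - \<alpha>) / Gamma \<alpha>\<close> of the fractional
    integral, by \<open>Gamma (\<alpha> + 1) = \<alpha> * Gamma \<alpha>\<close>.\<close>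
  define C where "C = \<rho> powr (- \<alpha>) / Gamma (\<alpha> + 1) * T powr \<alpha>"
  have Gam: "Gamma (\<alpha> + 1) = \<alpha> * Gamma \<alpha>" "Gamma \<alpha> > 0"
    using \<alpha> by (auto simp: Gamma_real_pos intro!: Gamma_plus1 elim!: nonpos_Ints_cases)
  have rho: "\<rho> powr (1 - \<alpha>) = \<rho> * \<rho> powr (- \<alpha>)"
    using \<rho> by (simp add: powr_diff powr_minus field_simps)
  have "C * (- (1 + (\<Sum>k=1..N. c k)) * x t) = - (A_coeff \<alpha> \<rho> N * T powr \<alpha> * x t)"
    by (simp add: C_def A_coeff_def c_def algebra_simps)
  moreover have "C * (\<alpha> * \<rho> / T powr \<alpha> * J) = katugampola_integral a \<alpha> \<rho> x t"
    using Gam \<alpha> T by (simp add: C_def katugampola_integral_def J_def K_def rho)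
  moreover have "C * (\<Sum>k=1..N. c k * k * \<rho> / T ^ k * V_fun a \<rho> x k t)
      = (\<Sum>k=1..N. B_coeff \<alpha> \<rho> k * T powr (\<alpha> - real k) * V_fun a \<rho> x k t)"
    unfolding sum_distrib_left
  proof (rule sum.cong[OF refl])
    fix k assume "k \<in> {1..N}"
    then have "fact k = real k * fact (k - 1)" "k > 0"
      by (auto simp: fact_reduce)
    then have "c k * k = Gamma_quot \<alpha> k / fact (k - 1)"
      by (simp add: c_def)
    moreover have "T powr (\<alpha> - real k) = T powr \<alpha> / T ^ k"
      using T by (simp add: powr_diff powr_realpow)
    ultimately show "C * (c k * k * \<rho> / T ^ k * V_fun a \<rho> x k t)
        = B_coeff \<alpha> \<rho> k * T powr (\<alpha> - real k) * V_fun a \<rho> x k t"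
      by (simp add: C_def B_coeff_def rho mult_ac)
  qed
  ultimately have "C * (- (1 + (\<Sum>k=1..N. c k)) * x t + \<alpha> * \<rho> / T powr \<alpha> * J
       + (\<Sum>k=1..N. c k * k * \<rho> / T ^ k * V_fun a \<rho> x k t))
     = katugampola_integral a \<alpha> \<rho> x t - A_coeff \<alpha> \<rho> N * T powr \<alpha> * x t
       + (\<Sum>k=1..N. B_coeff \<alpha> \<rho> k * T powr (\<alpha> - real k) * V_fun a \<rho> x k t)"
    unfolding distrib_left by linarith
  then show ?thesis
    using has_integral_mult_right[OF main, of C] by (simp add: C_def)
qed

section \<open>Passage to the limit\<close>

theorem theorem3p1:
  fixes a b \<alpha> \<rho> :: real
    and x :: "real \<Rightarrow> real"
    and E :: "nat \<Rightarrow> real \<Rightarrow> real"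
  assumes "0 \<le> a" and "a < b" and "\<alpha> > 0" and "\<rho> > 0"
    and "C1_on_interval a b x"
    and "\<And>N t. N \<ge> 1 \<Longrightarrow> t \<in> {a<..b} \<Longrightarrow>
      katugampola_integral a \<alpha> \<rho> x t =
        A_coeff \<alpha> \<rho> N * (t powr \<rho> - a powr \<rho>) powr \<alpha> * x t
        - (\<Sum>k=1..N. B_coeff \<alpha> \<rho> k * (t powr \<rho> - a powr \<rho>) powr (\<alpha> - real k) * V_fun a \<rho> x k t)
        + E N t"
  shows "\<forall>t\<in>{a<..b}. (\<lambda>N. E N t) \<longlonglongrightarrow> 0"
proof
  fix t assume t: "t \<in> {a<..b}"
  from \<open>C1_on_interval a b x\<close> obtain D
    where D: "\<And>\<tau>. \<tau> \<in> {a..b} \<Longrightarrow> (x has_real_derivative D \<tau>) (at \<tau> within {a..b})"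
      and cont_D: "continuous_on {a..b} D"
    unfolding C1_on_interval_def by blast
  have x: "continuous_on {a..t} x"
    using D t by (intro continuous_on_subset[OF DERIV_continuous_on[OF D]]) auto
  have D_interior: "(x has_real_derivative D \<tau>) (at \<tau>)" if "\<tau> \<in> {a<..<t}" for \<tau>
    using D[of \<tau>] that t at_within_interior[of \<tau> "{a..b}"] by simp
  obtain M where M: "\<And>\<tau>. \<tau> \<in> {a..b} \<Longrightarrow> \<bar>D \<tau>\<bar> \<le> M"
    using compact_imp_bounded[OF compact_continuous_image[OF cont_D]]
    unfolding bounded_iff by (metis compact_Icc image_eqI real_norm_def)
  define T where "T = t powr \<rho> - a powr \<rho>"
  define G where "G N \<tau> = (1 - (\<tau> powr \<rho> - a powr \<rho>) / T) powr \<alpha>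
      - (\<Sum>k\<le>N. Gamma_quot \<alpha> k / fact k * ((\<tau> powr \<rho> - a powr \<rho>) / T) ^ k)" for N \<tau>
  define C where "C = \<rho> powr (- \<alpha>) / Gamma (\<alpha> + 1) * T powr \<alpha>"
  define r where "r N = (\<Sum>k. \<bar>Gamma_quot \<alpha> (k + Suc N) / fact (k + Suc N)\<bar>)" for N
  have T: "T > 0"
    using assms t by (simp add: T_def powr_less_mono2)
  have r: "\<bar>G N \<tau>\<bar> \<le> r N" if "\<tau> \<in> {a..t}" for N \<tau>
    unfolding G_def r_def using assms that T
    by (intro binomial_series_remainder_bound) (auto simp: T_def powr_mono2)
  have "(\<lambda>N. \<Sum>k. \<bar>Gamma_quot \<alpha> (k + N) / fact (k + N)\<bar>) \<longlonglongrightarrow> 0"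
    using summable_abs_binomial_coefficients[OF \<open>\<alpha> > 0\<close>] by (rule suminf_exist_split2)
  \<comment> \<open>The Taylor polynomial includes the term of index N, so \<open>r N\<close> is the
    tail from \<open>Suc N\<close>; hence the shift.\<close>
  from LIMSEQ_Suc[OF this] have r_lim: "r \<longlonglongrightarrow> 0"
    by (simp add: r_def[abs_def] del: fact_Suc)
  have bound: "\<bar>E N t\<bar> \<le> r N * (\<bar>C\<bar> * M) * (t - a)" if "N \<ge> 1" for N
  proof -
    have "((\<lambda>\<tau>. C * (G N \<tau> * D \<tau>)) has_integral E N t) {a..t}"
      using remainder_integral[of a t \<alpha> \<rho> x D N] assms(1,3,4) assms(6)[OF that t] t x D_interior
      by (simp add: C_def G_def T_def)
    \<comment> \<open>The constant is absorbed into the derivative, so that \<open>r N\<close>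
      bounds one factor and \<open>\<bar>C\<bar> * M\<close>, independent of N, the other.\<close>
    then have "((\<lambda>\<tau>. G N \<tau> * (C * D \<tau>)) has_integral E N t) {a..t}"
      by (simp add: mult_ac)
    then show ?thesis
      using r M t
      by (intro has_integral_mult_abs_bound) (auto simp: abs_mult intro!: mult_left_mono)
  qed
  have "(\<lambda>N. r N * (\<bar>C\<bar> * M) * (t - a)) \<longlonglongrightarrow> 0"
    using r_lim by (auto intro: tendsto_mult_left_zero)
  then show "(\<lambda>N. E N t) \<longlonglongrightarrow> 0"
    by (rule Lim_null_comparison[rotated]) (auto intro!: eventually_sequentiallyI[of 1] bound)
qed

end
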